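(* Let $K,P\subset\mathbb{C}$ be compact sets with $K\cap\hat P=\emptyset$. Then there exist $w_1,w_2,\dots,w_m\in\mathbb{C}\setminus(K\cup\hat P)$ and $R_2>R_1>0$ such that, denoting by $f$ the function $z\mapsto\frac{1}{\prod_{j=1}^m(z-w_j)}$, we have $$K\subset\subset\{|f|<R_1\},\qquad P\subset\subset\{R_1<|f|<R_2\}.$$
   Context: $\hat P:=\{z\in\mathbb{C}:|p(z)|\le\max_{P}|p|\text{ for all complex polynomials }p\}$ is the polynomial hull of $P$. $A\subset\subset B$ means that the closure of $A$ is compact and contained in $B$. *)

theory Defs
  imports "HOL-Analysis.Analysis" "HOL-Computational_Algebra.Polynomial"
begin

text \<open>
  For compact nonempty \<open>P\<close> the supremum is the maximum. For empty \<open>P\<close> the supremum is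
  a fixed real number, and large constant polynomials make the hull empty, as is conventional.
\<close>

definition polynomial_hull :: "complex set \<Rightarrow> complex set" where
  "polynomial_hull P = {z. \<forall>p :: complex poly. norm (poly p z) \<le> (SUP w\<in>P. norm (poly p w))}"

definition compactly_contained :: "'a::topological_space set \<Rightarrow> 'a set \<Rightarrow> bool"
    (infix "\<subset>\<subset>" 50) where
  "A \<subset>\<subset> B \<longleftrightarrow> compact (closure A) \<and> closure A \<subseteq> B"

end

theory Submission
  imports Defs "HOL-Complex_Analysis.Conformal_Mappings"
begin

text \<open>
  Write \<open>E\<close> for the polynomial hull of \<open>P\<close>. The theorem asks for finitely many points \<open>w j\<close> outside
  \<open>K \<union> E\<close> such that \<open>\<Prod>j. (z - w j)\<close> is larger in modulus at every point of \<open>K\<close> than at every point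
  of \<open>E\<close>. In terms of logarithms, the sum over \<open>j\<close> of

    \<open>a (k, e) (w j) = ln \<bar>k - w j\<bar> - ln \<bar>e - w j\<bar>\<close>

  has to be positive for all \<open>k \<in> K\<close> and \<open>e \<in> E\<close> at once. The points \<open>w j\<close> are taken on the boundary \<open>G\<close>
  of a small neighbourhood \<open>D\<close> of \<open>E\<close>. This is a two-player game with payoff \<open>a\<close>, and the proof consists
  of showing that the player who chooses \<open>w \<in> G\<close> wins against every mixed strategy of the player who
  chooses \<open>(k, e)\<close>, followed by an explicit minimax argument.

  The answer to a mixed strategy comes from the maximum principle. The hull is compact and its complement
  is connected (\<open>connected_compl_polynomial_hull\<close>), so every \<open>k \<in> K\<close> can be joined to infinity without
  meeting \<open>G\<close>. Moving poles along such a connection yields a polynomial \<open>p\<close> with \<open>p 0 = 2\<close> and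
  \<open>\<bar>p (1 / (w - k))\<bar> < 1\<close> on \<open>G\<close> (\<open>pole_pushing\<close>). If \<open>M\<close> bounds the degree of \<open>p\<close>, then

    \<open>((w - k) / (w - e)) ^ M * p (1 / (w - k))\<close>

  is holomorphic outside \<open>e\<close>, has the value 2 at infinity, and is dominated on \<open>G\<close> by
  \<open>exp (M * a (k, e) w)\<close>. The maximum principle on the exterior of \<open>D\<close>, applied to products of powers of
  such functions, shows that every weighted average of the payoffs \<open>a (k, e)\<close> is at least \<open>ln 2 / M\<close> at
  some point of \<open>G\<close> (\<open>boundary_point_with_large_log_ratio_average\<close>). Since \<open>K\<close> is compact, one \<open>M\<close>
  serves for all \<open>k\<close>.

  The passage from averages to a single sequence is the multiplicative weights method: at each round the
  weight of \<open>(k, e)\<close> is exponentially small in its accumulated payoff, and \<open>w j\<close> is a good answer to these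
  weights (\<open>multiplicative_weights\<close>). It applies to a finite net of \<open>K \<times> E\<close>, and uniform continuity of the
  payoff extends the conclusion to all of \<open>K \<times> E\<close> because the gain \<open>ln 2 / M\<close> does not depend on the net.
\<close>

section \<open>Polynomial hulls and connections to infinity\<close>

lemma polynomial_hull_superset:
  assumes "compact P"
  shows "P \<subseteq> polynomial_hull P"
  unfolding polynomial_hull_def
proof safe
  fix z :: complex and p :: "complex poly" assume "z \<in> P"
  have "compact ((\<lambda>w. norm (poly p w)) ` P)"
    by (intro compact_continuous_image continuous_intros assms)
  then show "norm (poly p z) \<le> (SUP w\<in>P. norm (poly p w))"
    using \<open>z \<in> P\<close> by (intro cSUP_upper bounded_imp_bdd_above compact_imp_bounded)
qed

lemma compact_polynomial_hull: "compact (polynomial_hull P)"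
proof -
  have eq: "polynomial_hull P = (\<Inter>p. {z. norm (poly p z) \<le> (SUP w\<in>P. norm (poly p w))})"
    by (auto simp: polynomial_hull_def)
  have "closed (polynomial_hull P)"
    unfolding eq by (intro closed_INT ballI closed_Collect_le continuous_intros)
  moreover have "norm z \<le> (SUP w\<in>P. norm (poly [:0, 1:] w))" if "z \<in> polynomial_hull P" for z
  proof -
    have "norm (poly [:0, 1:] z) \<le> (SUP w\<in>P. norm (poly [:0, 1:] w))"
      using that unfolding polynomial_hull_def by blast
    then show ?thesis by simp
  qed
  then have "bounded (polynomial_hull P)" unfolding bounded_iff by blast
  ultimately show ?thesis by (simp add: compact_eq_bounded_closed)
qed

text \<open>
  A bounded component of the complement would have its boundary in the hull, so by the maximum principle
  its points would satisfy all inequalities that define the hull.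
\<close>

lemma connected_compl_polynomial_hull: "connected (- polynomial_hull P)"
proof (rule ccontr)
  let ?E = "polynomial_hull P"
  assume "\<not> connected (- ?E)"
  moreover have "closed ?E" "bounded ?E"
    using compact_polynomial_hull compact_imp_closed compact_imp_bounded by blast+
  ultimately obtain C where C: "C \<in> components (- ?E)" "bounded C"
    using cobounded_has_bounded_component[of "- ?E"] by auto
  then obtain z where "z \<in> C" "z \<notin> ?E"
    using in_components_nonempty in_components_subset by blast
  have "frontier C \<subseteq> ?E"
    using C(1) \<open>closed ?E\<close> by (simp add: frontier_of_components_closed_complement)
  have "norm (poly p z) \<le> (SUP w\<in>P. norm (poly p w))" for p
  proof (rule maximum_modulus_frontier[of "poly p" C])
    show "norm (poly p x) \<le> (SUP w\<in>P. norm (poly p w))" if "x \<in> frontier C" for x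
      using that \<open>frontier C \<subseteq> ?E\<close> by (auto simp: polynomial_hull_def)
  qed (use \<open>bounded C\<close> \<open>z \<in> C\<close> in \<open>auto intro!: holomorphic_intros continuous_intros\<close>)
  then have "z \<in> ?E" by (simp add: polynomial_hull_def)
  with \<open>z \<notin> ?E\<close> show False ..
qed

text \<open>
  The set \<open>T\<close> connects every point of \<open>K\<close> with infinity and keeps a positive distance from \<open>E\<close>. It
  consists of the exterior of a large disc and of finitely many paths from there to small discs that
  cover \<open>K\<close>.
\<close>

lemma cover_by_connected_closed_set:
  fixes K E :: "complex set"
  assumes "compact K" and "compact E" and "connected (- E)" and "K \<inter> E = {}" and "K \<noteq> {}"
  shows "\<exists>T. closed T \<and> connected T \<and> K \<subseteq> T \<and> T \<inter> E = {} \<and> bounded (- T)"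
proof -
  obtain R where "R > 0" and R: "E \<subseteq> ball 0 R"
    using \<open>compact E\<close> bounded_subset_ballD compact_imp_bounded by blast
  define Z where "Z = - ball (0 :: complex) R"
  have Z: "closed Z" "connected Z" "Z \<inter> E = {}"
    using R by (auto simp: Z_def intro!: connected_complement_bounded_convex)
  have zZ: "complex_of_real R \<in> Z" by (simp add: Z_def)
  have "open (- E)" using \<open>compact E\<close> compact_imp_closed by blast
  have "\<exists>Q r. r > 0 \<and> closed Q \<and> connected Q \<and> complex_of_real R \<in> Q \<and> Q \<inter> E = {} \<and> ball k r \<subseteq> Q" if "k \<in> K" for k
  proof -
    have "k \<in> - E" using that assms(4) by blast
    then obtain r where r: "r > 0" "cball k r \<subseteq> - E"
      using \<open>open (- E)\<close> open_contains_cball by blast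
    obtain g where g: "path g" "path_image g \<subseteq> - E" "pathstart g = k" "pathfinish g = complex_of_real R"
      using connected_open_path_connected[OF \<open>open (- E)\<close> assms(3)] \<open>k \<in> - E\<close> zZ Z(3)
      unfolding path_connected_def by blast
    have "k \<in> path_image g" "complex_of_real R \<in> path_image g"
      using g by (metis pathstart_in_path_image, metis pathfinish_in_path_image)
    moreover have "k \<in> cball k r" using r(1) by simp
    ultimately have "cball k r \<inter> path_image g \<noteq> {}" by blast
    then have "connected (cball k r \<union> path_image g)"
      using g(1) by (intro connected_Un connected_path_image convex_connected) auto
    moreover have "closed (cball k r \<union> path_image g)"
      using g(1) by (simp add: closed_path_image closed_Un)
    moreover have "ball k r \<subseteq> cball k r \<union> path_image g" by auto
    moreover have "(cball k r \<union> path_image g) \<inter> E = {}" using r g by blast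
    moreover have "complex_of_real R \<in> cball k r \<union> path_image g"
      using g by (metis UnI2 pathfinish_in_path_image)
    ultimately show ?thesis using r(1) by blast
  qed
  then obtain Q r where Qr: "\<And>k. k \<in> K \<Longrightarrow> r k > (0::real) \<and> closed (Q k) \<and> connected (Q k) \<and>
      complex_of_real R \<in> Q k \<and> Q k \<inter> E = {} \<and> ball k (r k) \<subseteq> Q k"
    by metis
  have "K \<subseteq> (\<Union>k\<in>K. ball k (r k))" using Qr by force
  then obtain F where F: "F \<subseteq> K" "finite F" "K \<subseteq> (\<Union>k\<in>F. ball k (r k))"
    using compactE_image[OF \<open>compact K\<close>, of K "\<lambda>k. ball k (r k)"] by blast
  define T where "T = Z \<union> (\<Union>k\<in>F. Q k)"
  have "T = \<Union> (insert Z (Q ` F))" by (simp add: T_def)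
  moreover have "connected (\<Union> (insert Z (Q ` F)))"
    using Z zZ Qr F(1) by (intro connected_Union) blast+
  ultimately have "connected T" by simp
  moreover have "closed T" unfolding T_def using Z F Qr by (intro closed_Un closed_UN) auto
  moreover have "K \<subseteq> T" unfolding T_def using F Qr by blast
  moreover have "T \<inter> E = {}" unfolding T_def using F Qr Z by blast
  moreover have "bounded (- T)"
    by (rule bounded_subset[OF bounded_ball[of 0 R]]) (auto simp: T_def Z_def)
  ultimately show ?thesis by blast
qed

section \<open>Moving poles\<close>

text \<open>
  If \<open>k\<close> is much closer to \<open>k'\<close> than \<open>G\<close> is, then \<open>1 / (w - k)\<close> expands on \<open>G\<close> into the geometric series
  \<open>\<Sum>j. (k - k') ^ j / (w - k') ^ (j + 1)\<close>. Its partial sums are polynomials in \<open>1 / (w - k')\<close> without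
  constant term, so composing \<open>p\<close> with one of them leaves the value at 0 unchanged.
\<close>

lemma pole_pushing_step:
  fixes G :: "complex set" and k k' :: complex and p :: "complex poly"
  assumes "compact G" and "k \<notin> G" and "k' \<notin> G"
    and close: "\<And>w. w \<in> G \<Longrightarrow> 2 * dist k k' \<le> dist w k'"
    and small: "\<And>w. w \<in> G \<Longrightarrow> norm (poly p (inverse (w - k))) < 1"
  shows "\<exists>q. poly q 0 = poly p 0 \<and> (\<forall>w\<in>G. norm (poly q (inverse (w - k'))) < 1)"
proof -
  define X where "X = (\<lambda>w. inverse (w - k)) ` G"
  have nz: "w - k \<noteq> 0" "w - k' \<noteq> 0" if "w \<in> G" for w
    using that assms(2,3) by auto
  have "compact X"
    unfolding X_def using nz by (intro compact_continuous_image continuous_intros assms) auto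
  moreover have "open {x. norm (poly p x) < 1}"
    by (intro open_Collect_less continuous_intros)
  moreover have "X \<subseteq> {x. norm (poly p x) < 1}"
    using small by (auto simp: X_def)
  ultimately obtain e where "e > 0" and e: "(\<Union>x\<in>X. ball x e) \<subseteq> {x. norm (poly p x) < 1}"
    using compact_subset_open_imp_ball_epsilon_subset by metis
  obtain B where "B > 0" and B: "\<And>x. x \<in> X \<Longrightarrow> norm x \<le> B"
    using \<open>compact X\<close> compact_imp_bounded bounded_pos by metis
  \<comment> \<open>The error of the \<open>n\<close>-th partial sum on \<open>G\<close> is at most \<open>B * (1/2) ^ n\<close>.\<close>
  obtain n where n: "(1/2) ^ n < e / B"
    using real_arch_pow_inv[of "e / B" "1/2"] \<open>e > 0\<close> \<open>B > 0\<close> by auto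
  define S where "S = (\<Sum>j<n. monom ((k - k') ^ j) (Suc j))"
  have S: "poly S x = x * (\<Sum>j<n. ((k - k') * x) ^ j)" for x
    by (simp add: S_def poly_sum poly_monom sum_distrib_left power_mult_distrib mult_ac)
  have "norm (poly (pcompose p S) (inverse (w - k'))) < 1" if w: "w \<in> G" for w
  proof -
    define x where "x = inverse (w - k')"
    define r where "r = (k - k') * x"
    have "norm r = dist k k' / dist w k'"
      by (simp add: r_def x_def norm_mult norm_inverse dist_norm divide_inverse)
    also have "\<dots> \<le> 1/2"
      using close[OF w] nz[OF w] by (simp add: divide_simps)
    finally have r: "norm r \<le> 1/2" .
    then have "r \<noteq> 1" by auto
    have "x / (1 - r) = inverse (w - k)"
      using nz[OF w] \<open>r \<noteq> 1\<close> by (simp add: r_def x_def field_simps)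
    moreover have "poly S x = x / (1 - r) * (1 - r ^ n)"
      using \<open>r \<noteq> 1\<close> sum_gp_strict[of r n] by (simp add: S flip: r_def)
    ultimately have "inverse (w - k) - poly S x = inverse (w - k) * r ^ n"
      by (simp add: algebra_simps)
    then have "dist (inverse (w - k)) (poly S x) = norm (inverse (w - k)) * norm r ^ n"
      by (simp add: dist_norm norm_mult norm_power)
    also have "\<dots> \<le> B * (1/2) ^ n"
      using B[of "inverse (w - k)"] w r \<open>B > 0\<close> by (intro mult_mono power_mono) (auto simp: X_def)
    also have "\<dots> < e"
      using n \<open>B > 0\<close> by (simp add: field_simps)
    finally have "poly S x \<in> (\<Union>x\<in>X. ball x e)"
      using w by (auto simp: X_def)
    with e have "poly S x \<in> {x. norm (poly p x) < 1}" by blast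
    then show ?thesis by (simp add: poly_pcompose x_def)
  qed
  moreover have "poly (pcompose p S) 0 = poly p 0"
    by (simp add: poly_pcompose S)
  ultimately show ?thesis by blast
qed

text \<open>
  In the variable \<open>w\<close>, the function \<open>p (1 / (w - k))\<close> has its only pole at \<open>k\<close>, has the value 2 at infinity
  and is smaller than 1 on \<open>G\<close>. The points \<open>k\<close> that admit such a \<open>p\<close> form a set that is open and closed
  in \<open>T\<close>, and it contains all points of \<open>T\<close> that are far from \<open>G\<close>.
\<close>

lemma pole_pushing:
  fixes G T :: "complex set"
  assumes "compact G" and "connected T" and "T \<inter> G = {}"
    and "\<not> bounded T" and "k \<in> T"
  shows "\<exists>p :: complex poly. poly p 0 = 2 \<and> (\<forall>w\<in>G. norm (poly p (inverse (w - k))) < 1)"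
proof -
  let ?good = "\<lambda>k. \<exists>p :: complex poly. poly p 0 = 2 \<and> (\<forall>w\<in>G. norm (poly p (inverse (w - k))) < 1)"
  obtain R where "R > 0" and R: "\<And>w. w \<in> G \<Longrightarrow> norm w \<le> R"
    using assms(1) compact_imp_bounded bounded_pos by metis
  obtain z where z: "z \<in> T" "norm z > 3 * R"
    using assms(4) unfolding bounded_iff by (meson not_le)
  \<comment> \<open>The witness \<open>2 + 2 * z * x\<close> takes the value \<open>2 * w / (w - z)\<close> at \<open>x = 1 / (w - z)\<close>.\<close>
  have "?good z"
  proof (intro exI conjI ballI)
    fix w assume "w \<in> G"
    then have "norm w \<le> R" using R by blast
    moreover have "norm (w - z) \<ge> norm z - norm w"
      by (metis norm_minus_commute norm_triangle_ineq2)
    ultimately have *: "norm (w - z) > 2 * norm w" using z by linarith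
    then have "w - z \<noteq> 0" by auto
    then have "poly [:2, 2 * z:] (inverse (w - z)) = 2 * w * inverse (w - z)"
      by (simp add: field_simps)
    then show "norm (poly [:2, 2 * z:] (inverse (w - z))) < 1"
      using * \<open>w - z \<noteq> 0\<close>
      unfolding \<open>poly _ _ = _\<close> by (simp add: norm_mult norm_inverse norm_divide field_simps del: right_minus_eq)
  qed simp
  show ?thesis
  proof (rule connected_induction_simple[where P = ?good, OF assms(2) z(1) assms(5) \<open>?good z\<close>])
    fix a assume "a \<in> T"
    obtain d where "d > 0" and d: "\<And>w. w \<in> G \<Longrightarrow> d \<le> dist a w"
      using separate_point_closed[of G a] \<open>a \<in> T\<close> assms(1,3) compact_imp_closed by blast
    show "\<exists>U. openin (top_of_set T) U \<and> a \<in> U \<and> (\<forall>x\<in>U. \<forall>y\<in>U. ?good x \<longrightarrow> ?good y)"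
    proof (rule exI, intro conjI ballI impI)
      show "openin (top_of_set T) (T \<inter> ball a (d / 8))"
        by (intro openin_open_Int open_ball)
      show "a \<in> T \<inter> ball a (d / 8)" using \<open>a \<in> T\<close> \<open>d > 0\<close> by simp
      fix x y assume xy: "x \<in> T \<inter> ball a (d / 8)" "y \<in> T \<inter> ball a (d / 8)" and "?good x"
      then obtain p :: "complex poly" where p: "poly p 0 = 2"
        "\<And>w. w \<in> G \<Longrightarrow> norm (poly p (inverse (w - x))) < 1" by blast
      have "2 * dist x y \<le> dist w y" if "w \<in> G" for w
      proof -
        have "d \<le> dist a y + dist w y"
          using d[OF that] dist_triangle[of a w y] by (simp add: dist_commute)
        moreover have "dist x y \<le> dist a x + dist a y"
          by (metis dist_commute dist_triangle)
        moreover have "dist a x < d / 8" "dist a y < d / 8" using xy by simp_all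
        ultimately show ?thesis using \<open>d > 0\<close> by linarith
      qed
      then show "?good y"
        using pole_pushing_step[of G x y p] assms(1,3) xy p by auto
    qed
  qed
qed

text \<open>
  A polynomial that works for \<open>k\<close> also works for all points of \<open>K\<close> near \<open>k\<close>. Compactness of \<open>K\<close>
  reduces the choice to finitely many polynomials, whose degrees have a common bound.
\<close>

lemma finitely_many_separating_polynomials:
  fixes G K :: "complex set"
  assumes "compact G" and "compact K" and "K \<inter> G = {}"
    and ex: "\<And>k. k \<in> K \<Longrightarrow> \<exists>p. p \<in> Q \<and> (\<forall>w\<in>G. norm (poly p (inverse (w - k))) < 1)"
  shows "\<exists>F. finite F \<and> F \<subseteq> Q \<and> (\<forall>k\<in>K. \<exists>p\<in>F. \<forall>w\<in>G. norm (poly p (inverse (w - k))) < 1)"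
proof -
  define bad where "bad p = fst ` {x \<in> K \<times> G. 1 \<le> norm (poly p (inverse (snd x - fst x)))}" for p :: "complex poly"
  have bad: "k \<in> - bad p \<longleftrightarrow> (\<forall>w\<in>G. norm (poly p (inverse (w - k))) < 1)" if "k \<in> K" for k p
    using that by (force simp: bad_def image_iff not_le)
  \<comment> \<open>The projection of a compact subset of \<open>K \<times> G\<close> is compact, hence closed.\<close>
  have "open (- bad p)" for p
  proof -
    have "continuous_on (K \<times> G) (\<lambda>x. norm (poly p (inverse (snd x - fst x))))"
      using assms(3) by (intro continuous_intros) auto
    then have "compact (K \<times> G \<inter> (\<lambda>x. norm (poly p (inverse (snd x - fst x)))) -` {1..})"
      using compact_Times[OF assms(2,1)] compact_Int_closed[OF compact_Times[OF assms(2,1)]]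
        continuous_closed_preimage compact_imp_closed closed_atLeast
      by (metis (no_types, lifting) Int_left_absorb)
    moreover have "K \<times> G \<inter> (\<lambda>x. norm (poly p (inverse (snd x - fst x)))) -` {1..}
        = {x \<in> K \<times> G. 1 \<le> norm (poly p (inverse (snd x - fst x)))}" by blast
    ultimately have "compact {x \<in> K \<times> G. 1 \<le> norm (poly p (inverse (snd x - fst x)))}" by metis
    then have "closed (bad p)"
      unfolding bad_def by (intro compact_imp_closed compact_continuous_image continuous_intros)
    then show ?thesis by auto
  qed
  moreover have "K \<subseteq> (\<Union>p\<in>Q. - bad p)" using ex bad by blast
  ultimately obtain F where "F \<subseteq> Q" "finite F" "K \<subseteq> (\<Union>p\<in>F. - bad p)"
    using compactE_image[OF assms(2), of Q "\<lambda>p. - bad p"] by blast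
  then show ?thesis using bad by (intro exI[of _ F]) blast
qed

section \<open>Averages of logarithms and the maximum principle\<close>

text \<open>
  The maximum principle on the complement of \<open>D\<close> in the Riemann sphere: the inversion
  \<open>z \<mapsto> c + 1 / z\<close> turns this complement into a bounded set around 0, and the limit at infinity makes the
  transformed function continuous, hence holomorphic, at 0.
\<close>

lemma exterior_maximum_modulus:
  fixes f :: "complex \<Rightarrow> complex" and D :: "complex set"
  assumes "open D" and "bounded D" and "c \<in> D"
    and hol: "f holomorphic_on - E" and "E \<subseteq> D"
    and lim: "(f \<longlongrightarrow> L) at_infinity"
  shows "\<exists>w\<in>frontier D. norm L \<le> norm (f w)"
proof -
  define h where "h = (\<lambda>z. c + inverse z)"
  define S where "S = {z. z = 0 \<or> h z \<notin> D}"
  define g where "g = (\<lambda>z. if z = 0 then L else f (h z))"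
  have frD: "frontier D \<inter> D = {}"
    using \<open>open D\<close> by (simp add: frontier_disjoint_eq)
  have "D \<noteq> UNIV" using \<open>bounded D\<close> not_bounded_UNIV by blast
  then have "frontier D \<noteq> {}" using \<open>c \<in> D\<close> frontier_eq_empty by blast
  moreover have "compact (frontier D)"
    using \<open>bounded D\<close> by (simp add: compact_frontier_bounded)
  moreover have "continuous_on (frontier D) (\<lambda>w. norm (f w))"
    using frD \<open>E \<subseteq> D\<close> by (intro continuous_intros continuous_on_subset[OF holomorphic_on_imp_continuous_on[OF hol]]) auto
  ultimately obtain w0 where w0: "w0 \<in> frontier D" "\<And>w. w \<in> frontier D \<Longrightarrow> norm (f w) \<le> norm (f w0)"
    using continuous_attains_sup by metis
  have conth: "continuous_on (- {0}) h"
    unfolding h_def by (intro continuous_intros) auto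
  have opn: "open (- {0} \<inter> h -` A)" if "open A" for A
    using continuous_on_open_vimage[of "- {0}" h] conth that
    by (metis Int_commute closed_singleton open_Compl)
  \<comment> \<open>As \<open>inverse 0 = 0\<close> and \<open>c \<in> D\<close>, the point 0 has to be excluded from the preimage of \<open>D\<close>.\<close>
  have compl: "- S = - {0} \<inter> h -` D" by (auto simp: S_def)
  then have "open (- S)" using opn[OF \<open>open D\<close>] by simp
  then have "closed S" by (simp add: closed_def)
  obtain b where "b > 0" and b: "\<And>x. x \<in> D \<Longrightarrow> norm (x - c) \<le> b"
    using bounded_translation_minus[OF \<open>bounded D\<close>, of c] unfolding bounded_pos by auto
  have "ball 0 (1 / b) \<subseteq> S"
  proof
    fix z :: complex assume "z \<in> ball 0 (1 / b)"
    then have "norm z < 1 / b" by simp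
    then have "z = 0 \<or> norm (inverse z) > b"
      using \<open>b > 0\<close> by (cases "z = 0") (simp_all add: norm_inverse norm_divide field_simps)
    then show "z \<in> S" using b[of "h z"] by (auto simp: S_def h_def)
  qed
  then have "0 \<in> interior S" 
    using \<open>b > 0\<close> by (meson centre_in_ball interior_maximal open_ball subsetD zero_less_divide_1_iff)
  obtain d where "d > 0" and d: "ball c d \<subseteq> D"
    using \<open>open D\<close> \<open>c \<in> D\<close> openE by blast
  have "bounded S"
    unfolding bounded_iff
  proof (intro exI ballI)
    fix z assume "z \<in> S"
    show "norm z \<le> 1 / d"
    proof (cases "z = 0")
      case False
      then have "h z \<notin> ball c d" using \<open>z \<in> S\<close> d by (auto simp: S_def)
      then have "d \<le> inverse (norm z)" by (simp add: h_def dist_norm norm_inverse)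
      then show ?thesis using False \<open>d > 0\<close> by (simp add: field_simps)
    qed (use \<open>d > 0\<close> in simp)
  qed
  have hS: "h z \<notin> E" if "z \<in> S" "z \<noteq> 0" for z
    using that \<open>E \<subseteq> D\<close> by (auto simp: S_def)
  have holg: "g holomorphic_on S - {0}"
  proof (rule holomorphic_transform)
    show "(f \<circ> h) holomorphic_on S - {0}"
      unfolding h_def
      by (rule holomorphic_on_compose_gen[OF _ hol]) (use hS in \<open>auto intro!: holomorphic_intros simp: h_def\<close>)
  qed (auto simp: g_def)
  have "continuous_on S g"
  proof -
    have "isCont g 0"
    proof -
      have "filterlim h at_infinity (at 0)"
        unfolding h_def
        by (intro tendsto_add_filterlim_at_infinity[OF tendsto_const] filterlim_inverse_at_infinity)
      then have "((\<lambda>z. f (h z)) \<longlongrightarrow> L) (at 0)"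
        using lim by (rule filterlim_compose[rotated])
      then have "(g \<longlongrightarrow> L) (at 0)"
        by (rule Lim_transform_eventually) (auto simp: g_def eventually_at_filter)
      then show ?thesis by (simp add: isCont_def g_def)
    qed
    moreover have "continuous (at z within S) g" if "z \<in> S" "z \<noteq> 0" for z
    proof -
      have "continuous (at z within S - {0}) g"
        using holomorphic_on_imp_continuous_on[OF holg] that
        by (auto simp: continuous_on_eq_continuous_within)
      moreover have "at z within S - {0} = at z within S"
        using that by (intro at_within_nhd[of z "- {0}"]) auto
      ultimately show ?thesis by simp
    qed
    ultimately show ?thesis
      by (metis continuous_at_imp_continuous_at_within continuous_on_eq_continuous_within)
  qed
  have "g holomorphic_on interior S"
    by (rule no_isolated_singularity[of _ _ "{0}"])
      (use \<open>continuous_on S g\<close> holg interior_subset in \<open>auto intro: continuous_on_subset holomorphic_on_subset\<close>)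
  moreover have "norm (g z) \<le> norm (f w0)" if "z \<in> frontier S" for z
  proof -
    have "z \<in> S" using that \<open>closed S\<close> frontier_subset_closed by blast
    have "z \<noteq> 0" using that \<open>0 \<in> interior S\<close> by (auto simp: frontier_def)
    then have "h z \<notin> D" using \<open>z \<in> S\<close> by (auto simp: S_def)
    moreover have "h z \<in> closure D"
    proof (rule ccontr)
      assume "h z \<notin> closure D"
      let ?A = "- {0} \<inter> h -` (- closure D)"
      have "?A \<subseteq> S" using closure_subset[of D] by (auto simp: S_def)
      moreover have "open ?A" by (rule opn) (simp add: open_Compl)
      moreover have "z \<in> ?A" using \<open>z \<noteq> 0\<close> \<open>h z \<notin> closure D\<close> by simp
      ultimately have "z \<in> interior S" using interior_maximal[of ?A S] by blast
      then show False using that by (auto simp: frontier_def)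
    qed
    ultimately have "h z \<in> frontier D"
      using \<open>open D\<close> by (simp add: frontier_def interior_open)
    then show ?thesis using w0 \<open>z \<noteq> 0\<close> by (simp add: g_def)
  qed
  ultimately have "norm (g 0) \<le> norm (f w0)"
    using maximum_modulus_frontier[of g S] \<open>continuous_on S g\<close> \<open>closed S\<close> \<open>bounded S\<close>
    by (simp add: S_def)
  then show ?thesis using w0 by (auto simp: g_def)
qed

text \<open>
  With integer weights \<open>n\<close>, the product of the functions
  \<open>(((w - k) / (w - e)) ^ M * p k (1 / (w - k))) ^ n (k, e)\<close> is a rational function with poles only at the
  points \<open>e \<in> D\<close>. Its value at infinity is a power of 2, and at some point of the boundary of \<open>D\<close> it is at
  least as large. There, dropping the factors with \<open>\<bar>p k (1 / (w - k))\<bar> < 1\<close> and taking logarithms gives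
  the claim.
\<close>

lemma boundary_point_with_large_log_ratio_average:
  fixes D :: "complex set" and X :: "(complex \<times> complex) set" and p :: "complex \<Rightarrow> complex poly"
  assumes "open D" and "bounded D" and "c \<in> D"
    and "finite X" and "M \<ge> 1"
    and kX: "\<And>k e. (k, e) \<in> X \<Longrightarrow> k \<notin> frontier D \<and> e \<in> D \<and> degree (p k) \<le> M \<and> poly (p k) 0 = 2"
    and small: "\<And>k e w. (k, e) \<in> X \<Longrightarrow> w \<in> frontier D \<Longrightarrow> norm (poly (p k) (inverse (w - k))) < 1"
  shows "\<exists>w\<in>frontier D. (\<Sum>(k, e)\<in>X. real (n (k, e)) * (ln (norm (k - w)) - ln (norm (e - w))))
    \<ge> ln 2 / M * (\<Sum>x\<in>X. real (n x))"
proof -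
  \<comment> \<open>\<open>A k\<close> is the polynomial \<open>(w - k) ^ M * p k (1 / (w - k))\<close>, written in a form that makes sense at \<open>w = k\<close>.\<close>
  define A where "A k w = (\<Sum>i\<le>M. coeff (p k) i * (w - k) ^ (M - i))" for k w
  define f where "f w = (\<Prod>(k, e)\<in>X. (A k w / (w - e) ^ M) ^ n (k, e))" for w
  have A: "A k w = (w - k) ^ M * poly (p k) (inverse (w - k))"
    if "w \<noteq> k" "(k, e) \<in> X" for k e w
  proof -
    have "poly (p k) (inverse (w - k)) = (\<Sum>i\<le>M. coeff (p k) i * inverse (w - k) ^ i)"
      unfolding poly_altdef using kX[OF that(2)]
      by (intro sum.mono_neutral_left) (auto simp: coeff_eq_0)
    then show ?thesis
      using that(1) by (auto simp: A_def sum_distrib_left power_diff field_simps intro!: sum.cong)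
  qed
  have "(f \<longlongrightarrow> (\<Prod>(k, e)\<in>X. 2 ^ n (k, e))) at_infinity"
    unfolding f_def case_prod_beta
  proof (intro tendsto_prod tendsto_power)
    fix x assume "x \<in> X"
    obtain k e where x: "x = (k, e)" by fastforce
    have "filterlim (\<lambda>w::complex. w - a) at_infinity at_infinity" for a
      using tendsto_add_filterlim_at_infinity[OF tendsto_const[of "-a"] filterlim_ident[of at_infinity]] by simp
    then have inv: "((\<lambda>w. inverse (w - a)) \<longlongrightarrow> 0) at_infinity" for a :: complex
      using filterlim_compose[OF tendsto_inverse_0] by blast
    have "((\<lambda>w. (1 + (e - k) * inverse (w - e)) ^ M * poly (p k) (inverse (w - k)))
        \<longlongrightarrow> (1 + (e - k) * 0) ^ M * poly (p k) 0) at_infinity"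
      by (intro tendsto_intros inv)
    moreover have "\<forall>\<^sub>F w in at_infinity. (1 + (e - k) * inverse (w - e)) ^ M * poly (p k) (inverse (w - k))
        = A k w / (w - e) ^ M"
    proof -
      have "\<forall>\<^sub>F w in at_infinity. w \<noteq> k \<and> w \<noteq> e"
        by (auto simp: eventually_conj_iff eventually_not_equal_at_infinity)
      then show ?thesis
      proof eventually_elim
        case (elim w)
        then have "1 + (e - k) * inverse (w - e) = (w - k) / (w - e)" by (simp add: field_simps)
        then show ?case using A[of w k e] elim \<open>x \<in> X\<close> x by (simp add: power_divide)
      qed
    qed
    ultimately show "((\<lambda>w. A (fst x) w / (w - snd x) ^ M) \<longlongrightarrow> 2) at_infinity"
      using kX \<open>x \<in> X\<close> by (auto simp: x intro: Lim_transform_eventually)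
  qed
  moreover have "f holomorphic_on - (snd ` X)"
    unfolding f_def A_def case_prod_beta
    by (intro holomorphic_intros) auto
  ultimately obtain w where w: "w \<in> frontier D" 
    and le: "norm (\<Prod>(k, e)\<in>X. (2::complex) ^ n (k, e)) \<le> norm (f w)"
    using exterior_maximum_modulus[OF assms(1-3), of f "snd ` X"] kX by force
  have "w \<notin> D" using w \<open>open D\<close> by (auto simp: frontier_def interior_open)
  have pos: "norm (k - w) > 0" "norm (e - w) > 0" if "(k, e) \<in> X" for k e
    using kX[OF that] w \<open>w \<notin> D\<close> by auto
  have "(\<Prod>x\<in>X. 2 ^ n x) = norm (\<Prod>(k, e)\<in>X. (2::complex) ^ n (k, e))"
    by (simp add: prod_norm norm_power case_prod_beta flip: prod_norm)
  also note le
  also have "norm (f w) = (\<Prod>x\<in>X. norm (A (fst x) w / (w - snd x) ^ M) ^ n x)"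
    by (simp add: f_def case_prod_beta norm_power flip: prod_norm)
  also have "\<dots> \<le> (\<Prod>x\<in>X. (norm (fst x - w) ^ M / norm (snd x - w) ^ M) ^ n x)"
  proof (intro prod_mono conjI power_mono)
    fix x assume "x \<in> X"
    obtain k e where x: "x = (k, e)" by fastforce
    have "w \<noteq> k" using pos \<open>x \<in> X\<close> x by auto
    then have "norm (A k w) \<le> norm (k - w) ^ M * 1"
      using A[of w k e] small[of k e w] w \<open>x \<in> X\<close> x
      by (auto simp: norm_mult norm_power norm_minus_commute intro!: mult_left_mono)
    then show "norm (A (fst x) w / (w - snd x) ^ M) \<le> norm (fst x - w) ^ M / norm (snd x - w) ^ M"
      by (simp add: x norm_divide norm_power norm_minus_commute divide_right_mono)
  qed auto
  finally have "ln (\<Prod>x\<in>X. (2::real) ^ n x) \<le> ln (\<Prod>x\<in>X. (norm (fst x - w) ^ M / norm (snd x - w) ^ M) ^ n x)"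
    by (intro ln_mono) (auto intro!: prod_pos)
  also have "ln (\<Prod>x\<in>X. (2::real) ^ n x) = ln 2 * (\<Sum>x\<in>X. real (n x))"
    by (subst ln_prod) (auto simp: ln_realpow sum_distrib_left mult_ac \<open>finite X\<close>)
  also have "ln (\<Prod>x\<in>X. (norm (fst x - w) ^ M / norm (snd x - w) ^ M) ^ n x)
      = (\<Sum>x\<in>X. n x * (M * (ln (norm (fst x - w)) - ln (norm (snd x - w)))))"
    using pos by (subst ln_prod) (force simp: ln_realpow ln_div algebra_simps \<open>finite X\<close> intro!: sum.cong)+
  also have "\<dots> = M * (\<Sum>(k, e)\<in>X. real (n (k, e)) * (ln (norm (k - w)) - ln (norm (e - w))))"
    by (simp add: case_prod_beta sum_distrib_left mult_ac)
  finally show ?thesis using w \<open>M \<ge> 1\<close> by (auto simp: field_simps)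
qed

section \<open>From averages to a single sequence\<close>

text \<open>
  Integer weights suffice for the maximum principle, whereas the weights of the iteration below are real.
  Rounding up \<open>N * \<mu> x\<close> changes each term by at most the bound \<open>B\<close> of the payoff, which for large \<open>N\<close>
  costs no more than half of the gain.
\<close>

lemma positive_weights_from_nat_weights:
  fixes a :: "'x \<Rightarrow> 'w \<Rightarrow> real"
  assumes "finite X" and "c > 0" and "B > 0"
    and bound: "\<And>x w. x \<in> X \<Longrightarrow> w \<in> G \<Longrightarrow> \<bar>a x w\<bar> \<le> B"
    and nat: "\<And>n :: 'x \<Rightarrow> nat. \<exists>w\<in>G. (\<Sum>x\<in>X. real (n x) * a x w) \<ge> c * (\<Sum>x\<in>X. real (n x))"
    and pos: "\<And>x. x \<in> X \<Longrightarrow> \<mu> x > (0::real)"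
  shows "\<exists>w\<in>G. (\<Sum>x\<in>X. \<mu> x * a x w) \<ge> c / 2 * (\<Sum>x\<in>X. \<mu> x)"
proof (cases "X = {}")
  case True
  then show ?thesis using nat by auto
next
  case False
  define s where "s = sum \<mu> X"
  have "s > 0" unfolding s_def using False assms(1) pos by (intro sum_pos) auto
  obtain N :: nat where N: "real N > 2 * card X * B / (c * s)"
    using reals_Archimedean2 by blast
  have "2 * card X * B / (c * s) \<ge> 0" using \<open>c > 0\<close> \<open>s > 0\<close> \<open>B > 0\<close> by simp
  then have "N > 0" using N by (metis not_gr_zero of_nat_0 not_less)
  define n where "n x = nat \<lceil>N * \<mu> x\<rceil>" for x
  have n: "N * \<mu> x \<le> n x" "n x \<le> N * \<mu> x + 1" if "x \<in> X" for x
    using pos[OF that] by (auto simp: n_def) 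
  obtain w where w: "w \<in> G" "(\<Sum>x\<in>X. real (n x) * a x w) \<ge> c * (\<Sum>x\<in>X. real (n x))"
    using nat by blast
  have "c * (N * s) \<le> c * (\<Sum>x\<in>X. real (n x))"
    using \<open>c > 0\<close> n by (simp add: s_def sum_distrib_left sum_mono)
  also note w(2)
  also have "(\<Sum>x\<in>X. real (n x) * a x w) \<le> (\<Sum>x\<in>X. N * \<mu> x * a x w + B)"
  proof (rule sum_mono)
    fix x assume x: "x \<in> X"
    have "(n x - N * \<mu> x) * a x w \<le> (n x - N * \<mu> x) * B"
      using n(1)[OF x] bound[OF x w(1)] by (intro mult_left_mono) linarith+
    also have "\<dots> \<le> 1 * B"
      using n(2)[OF x] \<open>B > 0\<close> by (intro mult_right_mono) linarith+
    finally have "(n x - N * \<mu> x) * a x w \<le> B" by simp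
    then show "real (n x) * a x w \<le> N * \<mu> x * a x w + B" by (simp add: algebra_simps)
  qed
  also have "\<dots> = N * (\<Sum>x\<in>X. \<mu> x * a x w) + card X * B"
    by (simp add: sum.distrib sum_distrib_left mult_ac)
  finally have "c * (N * s) \<le> N * (\<Sum>x\<in>X. \<mu> x * a x w) + card X * B" .
  moreover have "card X * B \<le> c / 2 * s * N"
    using N \<open>c > 0\<close> \<open>s > 0\<close> by (simp add: field_simps)
  ultimately have "N * (c / 2 * s) \<le> N * (\<Sum>x\<in>X. \<mu> x * a x w)"
    by (simp add: algebra_simps)
  then show ?thesis using \<open>N > 0\<close> w(1) by (auto simp: s_def)
qed

lemma exp_minus_le:
  fixes t :: real
  assumes "\<bar>t\<bar> \<le> 1 / 2"
  shows "exp (- t) \<le> 1 - t + 2 * t\<^sup>2"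
proof -
  \<comment> \<open>The right-hand side is compared with \<open>1 / (1 + t)\<close>, which bounds \<open>exp (- t)\<close>.\<close>
  have "1 \<le> 1 + t\<^sup>2 * (1 + 2 * t)" using assms by simp
  also have "\<dots> = (1 - t + 2 * t\<^sup>2) * (1 + t)" by (simp add: algebra_simps power2_eq_square)
  finally have "1 / (1 + t) \<le> 1 - t + 2 * t\<^sup>2"
    using assms by (simp add: divide_simps)
  moreover have "exp (- t) \<le> 1 / (1 + t)"
    using exp_ge_add_one_self[of t] assms by (simp add: exp_minus field_simps)
  ultimately show ?thesis by linarith
qed

text \<open>
  The potential \<open>\<Sum>x\<in>X. exp (- h * (\<Sum>j. a x (w j)))\<close> shrinks at least by the factor \<open>exp (- h * c / 2)\<close> in each
  round if the next \<open>w j\<close> is a good answer to the weights given by its terms. Therefore every single term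
  decays exponentially, and every accumulated payoff grows linearly.
\<close>

lemma multiplicative_weights:
  fixes a :: "'x \<Rightarrow> 'w \<Rightarrow> real"
  assumes "finite X" and "c > 0" and "B > 0"
    and bound: "\<And>x w. x \<in> X \<Longrightarrow> w \<in> G \<Longrightarrow> \<bar>a x w\<bar> \<le> B"
    and avg: "\<And>\<mu> :: 'x \<Rightarrow> real. (\<And>x. x \<in> X \<Longrightarrow> \<mu> x > 0) \<Longrightarrow>
      \<exists>w\<in>G. (\<Sum>x\<in>X. \<mu> x * a x w) \<ge> c * (\<Sum>x\<in>X. \<mu> x)"
  shows "\<exists>(m::nat) (w :: nat \<Rightarrow> 'w). m \<ge> 1 \<and> (\<forall>j\<in>{1..m}. w j \<in> G) \<and> (\<forall>x\<in>X. (\<Sum>j=1..m. a x (w j)) \<ge> c / 4 * m)"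
proof -
  \<comment> \<open>The first bound on \<open>h\<close> makes \<open>exp_minus_le\<close> applicable, the second one keeps the quadratic
     error at most half of the linear gain.\<close>
  define h where "h = min (1 / (2 * B)) (c / (4 * B\<^sup>2))"
  have "h > 0" using assms(2,3) by (simp add: h_def)
  have hB: "h * B \<le> 1 / 2"
  proof -
    have "h * B \<le> 1 / (2 * B) * B" using \<open>B > 0\<close> by (intro mult_right_mono) (auto simp: h_def)
    then show ?thesis using \<open>B > 0\<close> by simp
  qed
  have hc: "2 * (h * B)\<^sup>2 \<le> h * c / 2"
  proof -
    have "h * B\<^sup>2 \<le> c / (4 * B\<^sup>2) * B\<^sup>2" using \<open>B > 0\<close> by (intro mult_right_mono) (auto simp: h_def)
    then have "2 * h * (h * B\<^sup>2) \<le> 2 * h * (c / 4)" using \<open>B > 0\<close> \<open>h > 0\<close> by simp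
    then show ?thesis by (simp add: power2_eq_square mult_ac)
  qed
  have step: "\<exists>w :: nat \<Rightarrow> 'w. (\<forall>j\<in>{1..m}. w j \<in> G) \<and>
      (\<Sum>x\<in>X. exp (- h * (\<Sum>j=1..m. a x (w j)))) \<le> card X * exp (- h * c / 2 * m)" for m :: nat
  proof (induction m)
    case 0
    show ?case by simp
  next
    case (Suc m)
    then obtain w where w: "\<forall>j\<in>{1..m}. w j \<in> G"
      and le: "(\<Sum>x\<in>X. exp (- h * (\<Sum>j=1..m. a x (w j)))) \<le> card X * exp (- h * c / 2 * m)"
      by blast
    define \<mu> where "\<mu> x = exp (- h * (\<Sum>j=1..m. a x (w j)))" for x
    obtain v where v: "v \<in> G" "(\<Sum>x\<in>X. \<mu> x * a x v) \<ge> c * (\<Sum>x\<in>X. \<mu> x)"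
      using avg[of \<mu>] by (auto simp: \<mu>_def)
    let ?w = "w(Suc m := v)"
    have "(\<Sum>x\<in>X. exp (- h * (\<Sum>j=1..Suc m. a x (?w j)))) = (\<Sum>x\<in>X. \<mu> x * exp (- (h * a x v)))"
    proof (rule sum.cong)
      fix x assume "x \<in> X"
      have "(\<Sum>j=1..m. a x (?w j)) = (\<Sum>j=1..m. a x (w j))"
        by (intro sum.cong) auto
      then show "exp (- h * (\<Sum>j=1..Suc m. a x (?w j))) = \<mu> x * exp (- (h * a x v))"
        by (simp add: \<mu>_def algebra_simps flip: exp_add)
    qed simp
    also have "\<dots> \<le> (\<Sum>x\<in>X. \<mu> x * (1 - h * a x v + h * c / 2))"
    proof (intro sum_mono mult_left_mono)
      fix x assume "x \<in> X"
      then have *: "\<bar>h * a x v\<bar> \<le> h * B"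
        using bound v(1) \<open>h > 0\<close> by (simp add: abs_mult)
      then have "exp (- (h * a x v)) \<le> 1 - h * a x v + 2 * (h * a x v)\<^sup>2"
        using hB by (intro exp_minus_le) linarith
      moreover have "(h * a x v)\<^sup>2 \<le> (h * B)\<^sup>2"
        using * by (metis abs_ge_zero power2_abs power_mono)
      ultimately show "exp (- (h * a x v)) \<le> 1 - h * a x v + h * c / 2"
        using hc by linarith
    qed (simp add: \<mu>_def)
    also have "\<dots> = (1 + h * c / 2) * sum \<mu> X - h * (\<Sum>x\<in>X. \<mu> x * a x v)"
      by (simp add: algebra_simps sum.distrib sum_subtractf sum_distrib_left sum_distrib_right)
    also have "\<dots> \<le> (1 + h * c / 2) * sum \<mu> X - h * (c * sum \<mu> X)"
      using v(2) \<open>h > 0\<close> by simp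
    also have "\<dots> = (1 + (- h * c / 2)) * sum \<mu> X" by (simp add: algebra_simps)
    also have "\<dots> \<le> exp (- h * c / 2) * sum \<mu> X"
      using exp_ge_add_one_self[of "- h * c / 2"] by (intro mult_right_mono sum_nonneg) (auto simp: \<mu>_def)
    also have "\<dots> \<le> exp (- h * c / 2) * (card X * exp (- h * c / 2 * m))"
      using le by (intro mult_left_mono) (auto simp: \<mu>_def)
    also have "\<dots> = card X * exp (- h * c / 2 * Suc m)"
      by (simp add: algebra_simps add_divide_distrib diff_divide_distrib flip: exp_add)
    finally have "(\<Sum>x\<in>X. exp (- h * (\<Sum>j=1..Suc m. a x (?w j)))) \<le> card X * exp (- h * c / 2 * Suc m)" .
    moreover have "\<forall>j\<in>{1..Suc m}. ?w j \<in> G" using w v by auto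
    ultimately show ?case by blast
  qed
  \<comment> \<open>From this many rounds on, half of the exponential decay absorbs the factor \<open>card X\<close>.\<close>
  obtain m :: nat where m: "real m > max 1 (ln (card X + 1) / (h * c / 4))"
    using reals_Archimedean2 by blast
  then have "ln (card X + 1) < h * c / 4 * m"
    using \<open>h > 0\<close> \<open>c > 0\<close> by (simp add: field_simps)
  then have "card X + 1 < exp (h * c / 4 * m)"
    by (metis exp_less_cancel_iff exp_ln of_nat_0_less_iff add_gr_0 zero_less_one of_nat_add of_nat_1)
  obtain w where w: "\<forall>j\<in>{1..m}. w j \<in> G"
    and le: "(\<Sum>x\<in>X. exp (- h * (\<Sum>j=1..m. a x (w j)))) \<le> card X * exp (- h * c / 2 * m)"
    using step by blast
  have "(\<Sum>j=1..m. a x (w j)) \<ge> c / 4 * m" if "x \<in> X" for x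
  proof -
    have "exp (- h * (\<Sum>j=1..m. a x (w j))) \<le> (\<Sum>x\<in>X. exp (- h * (\<Sum>j=1..m. a x (w j))))"
      using that \<open>finite X\<close> by (intro member_le_sum) auto
    also note le
    also have "card X * exp (- h * c / 2 * m) \<le> exp (h * c / 4 * m) * exp (- h * c / 2 * m)"
      using \<open>card X + 1 < exp (h * c / 4 * m)\<close> by (intro mult_right_mono) auto
    also have "\<dots> = exp (- h * (c / 4 * m))" by (simp add: algebra_simps flip: exp_add)
    finally show ?thesis using \<open>h > 0\<close> by simp
  qed
  moreover have "m \<ge> 1" using m by simp
  ultimately show ?thesis using w by blast
qed

text \<open>
  A minimax principle for a continuous payoff on compact sets. The gain \<open>c\<close> is the same for all finite
  subsets of \<open>X\<close>, so the finite net can be chosen after \<open>c\<close>, so fine that moving to the nearest net point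
  changes the payoff by less than the gain that is left.
\<close>

lemma sequence_with_positive_sums:
  fixes a :: "'x::metric_space \<Rightarrow> 'w::metric_space \<Rightarrow> real"
  assumes "compact X" and "compact G" and cont: "continuous_on (X \<times> G) (\<lambda>(x, w). a x w)"
    and "c > 0"
    and nat: "\<And>F (n :: 'x \<Rightarrow> nat). finite F \<Longrightarrow> F \<subseteq> X \<Longrightarrow>
      \<exists>w\<in>G. (\<Sum>x\<in>F. real (n x) * a x w) \<ge> c * (\<Sum>x\<in>F. real (n x))"
  shows "\<exists>(m::nat) (w :: nat \<Rightarrow> 'w). m \<ge> 1 \<and> (\<forall>j\<in>{1..m}. w j \<in> G) \<and> (\<forall>x\<in>X. (\<Sum>j=1..m. a x (w j)) > 0)"
proof -
  have cpt: "compact (X \<times> G)" using assms(1,2) by (rule compact_Times)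
  then have "bounded ((\<lambda>(x, w). a x w) ` (X \<times> G))"
    using cont by (intro compact_imp_bounded compact_continuous_image)
  then obtain B where "B > 0" and B: "\<And>x w. x \<in> X \<Longrightarrow> w \<in> G \<Longrightarrow> \<bar>a x w\<bar> \<le> B"
    unfolding bounded_pos by fastforce
  have "c / 16 > 0" using \<open>c > 0\<close> by simp
  moreover have "uniformly_continuous_on (X \<times> G) (\<lambda>(x, w). a x w)"
    using cont cpt by (rule compact_uniformly_continuous)
  ultimately obtain r where "r > 0" and r': "\<forall>y\<in>X \<times> G. \<forall>y'\<in>X \<times> G. dist y' y < r \<longrightarrow>
      dist ((\<lambda>(x, w). a x w) y') ((\<lambda>(x, w). a x w) y) < c / 16"
    unfolding uniformly_continuous_on_def by metis
  have r: "\<bar>a x w - a x' w\<bar> < c / 16" if "x \<in> X" "x' \<in> X" "w \<in> G" "dist x x' < r" for x x' w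
    using r'[rule_format, of "(x', w)" "(x, w)"] that by (simp add: dist_Pair_Pair dist_real_def)
  have "X \<subseteq> (\<Union>x\<in>X. ball x r)" using \<open>r > 0\<close> by auto
  then obtain F where F: "F \<subseteq> X" "finite F" "X \<subseteq> (\<Union>x\<in>F. ball x r)"
    using compactE_image[OF \<open>compact X\<close>, of X "\<lambda>x. ball x r"] by (metis open_ball)
  have bd: "\<bar>a x w\<bar> \<le> B" if "x \<in> F" "w \<in> G" for x w
    using B F(1) that by blast
  have avg: "\<exists>w\<in>G. (\<Sum>x\<in>F. \<mu> x * a x w) \<ge> c / 2 * (\<Sum>x\<in>F. \<mu> x)"
    if "\<And>x. x \<in> F \<Longrightarrow> \<mu> x > 0" for \<mu>
    using F(2) \<open>c > 0\<close> \<open>B > 0\<close> bd nat[OF F(2,1)] that by (rule positive_weights_from_nat_weights)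
  have "\<exists>(m::nat) (w :: nat \<Rightarrow> 'w). m \<ge> 1 \<and> (\<forall>j\<in>{1..m}. w j \<in> G) \<and>
      (\<forall>x\<in>F. (\<Sum>j=1..m. a x (w j)) \<ge> c / 2 / 4 * m)"
    using F(2) half_gt_zero[OF \<open>c > 0\<close>] \<open>B > 0\<close> bd avg by (rule multiplicative_weights)
  then obtain m :: nat and w :: "nat \<Rightarrow> 'w" where m: "m \<ge> 1" and w: "\<forall>j\<in>{1..m}. w j \<in> G"
    and le: "\<forall>x\<in>F. (\<Sum>j=1..m. a x (w j)) \<ge> c / 2 / 4 * m"
    by blast
  have "0 < (\<Sum>j=1..m. a y (w j))" if "y \<in> X" for y
  proof -
    obtain x where x: "x \<in> F" "dist x y < r"
      using F(3) \<open>y \<in> X\<close> by fastforce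
    have "0 < c / 16 * m" using \<open>c > 0\<close> m by simp
    also have "\<dots> = c / 2 / 4 * m - (\<Sum>j=1..m. c / 16)" by simp
    also have "\<dots> \<le> (\<Sum>j=1..m. a x (w j)) - (\<Sum>j=1..m. c / 16)"
      using le x(1) by (intro diff_right_mono) blast
    also have "\<dots> = (\<Sum>j=1..m. a x (w j) - c / 16)" by (simp only: sum_subtractf)
    also have "\<dots> \<le> (\<Sum>j=1..m. a y (w j))"
    proof (rule sum_mono)
      fix j assume "j \<in> {1..m}"
      then have "\<bar>a x (w j) - a y (w j)\<bar> < c / 16"
        using r[of x y "w j"] x F(1) \<open>y \<in> X\<close> w by blast
      then show "a x (w j) - c / 16 \<le> a y (w j)" by linarith
    qed
    finally show ?thesis .
  qed
  then show ?thesis using m w by blast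
qed

section \<open>Separation by the modulus of a polynomial\<close>

text \<open>
  The conclusion is a form of Hilbert's lemniscate theorem in which the roots of the polynomial lie outside
  the set that it separates from \<open>K\<close>.
\<close>

lemma separating_roots:
  fixes K E :: "complex set"
  assumes "compact K" and "compact E" and "connected (- E)" and "K \<inter> E = {}"
    and "K \<noteq> {}" and "E \<noteq> {}"
  shows "\<exists>(m::nat) (w :: nat \<Rightarrow> complex). m \<ge> 1 \<and> (\<forall>j\<in>{1..m}. w j \<notin> K \<union> E) \<and>
    (\<forall>k\<in>K. \<forall>e\<in>E. norm (\<Prod>j=1..m. (e - w j)) < norm (\<Prod>j=1..m. (k - w j)))"
proof -
  obtain T where T: "closed T" "connected T" "K \<subseteq> T" "T \<inter> E = {}" "bounded (- T)"
    using cover_by_connected_closed_set assms by metis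
  obtain d where "d > 0" and d: "\<And>x y. x \<in> E \<Longrightarrow> y \<in> T \<Longrightarrow> d \<le> dist x y"
    using separate_compact_closed[OF assms(2) T(1)] T(4) by blast
  \<comment> \<open>Half the distance to \<open>T\<close> keeps the closure of \<open>D\<close> away from \<open>T\<close>.\<close>
  define D where "D = {x. infdist x E < d / 2}"
  define G where "G = frontier D"
  have "open D" unfolding D_def by (intro open_Collect_less continuous_intros)
  have "E \<subseteq> D" using \<open>d > 0\<close> by (auto simp: D_def)
  have "T \<inter> closure D = {}"
  proof -
    have "closed {x. infdist x E \<le> d / 2}" by (intro closed_Collect_le continuous_intros)
    then have "closure D \<subseteq> {x. infdist x E \<le> d / 2}"
      by (intro closure_minimal) (auto simp: D_def)
    moreover have "d \<le> infdist y E" if "y \<in> T" for y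
      using that d \<open>E \<noteq> {}\<close> by (auto simp: infdist_def dist_commute intro!: cINF_greatest)
    ultimately show ?thesis using \<open>d > 0\<close> by force
  qed
  then have TG: "T \<inter> G = {}" and "D \<subseteq> - T"
    using closure_subset[of D] by (auto simp: G_def frontier_def)
  have "bounded D" using T(5) \<open>D \<subseteq> - T\<close> bounded_subset by blast
  then have "compact G" by (simp add: G_def compact_frontier_bounded)
  have GE: "G \<inter> E = {}"
    using \<open>open D\<close> \<open>E \<subseteq> D\<close> by (auto simp: G_def frontier_def interior_open)
  obtain c where "c \<in> D" using \<open>E \<noteq> {}\<close> \<open>E \<subseteq> D\<close> by blast
  have KG: "K \<inter> G = {}" using T(3) TG by blast
  have "\<not> bounded T"
    using T(5) bounded_Un[of T "- T"] not_bounded_UNIV[where 'a = complex] by (simp add: Compl_partition)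
  then have "\<exists>p. p \<in> {p. poly p 0 = 2} \<and> (\<forall>w\<in>G. norm (poly p (inverse (w - k))) < 1)" if "k \<in> K" for k
    using pole_pushing[OF \<open>compact G\<close> T(2) TG _, of k] that T(3) by blast
  then obtain F where F: "finite F" "F \<subseteq> {p. poly p 0 = 2}"
      "\<forall>k\<in>K. \<exists>p\<in>F. \<forall>w\<in>G. norm (poly p (inverse (w - k))) < 1"
    using finitely_many_separating_polynomials[OF \<open>compact G\<close> assms(1) KG, of "{p. poly p 0 = 2}"]
    by metis
  then obtain p where p: "\<And>k. k \<in> K \<Longrightarrow> p k \<in> F"
      "\<And>k w. k \<in> K \<Longrightarrow> w \<in> G \<Longrightarrow> norm (poly (p k) (inverse (w - k))) < 1"
    by metis
  define M where "M = Suc (\<Sum>q\<in>F. degree q)"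
  have M: "degree q \<le> M" if "q \<in> F" for q
    using member_le_sum[of q F degree] that F(1) by (auto simp: M_def)
  define a where "a x w = ln (norm (fst x - w)) - ln (norm (snd x - w))" for x :: "complex \<times> complex" and w
  have nz: "k - w \<noteq> 0" "e - w \<noteq> 0" if "k \<in> K" "e \<in> E" "w \<in> G" for k e w
    using that KG GE by auto
  have cont: "continuous_on ((K \<times> E) \<times> G) (\<lambda>(x, w). a x w)"
    unfolding a_def case_prod_beta
    by (intro continuous_intros ballI; clarsimp; metis nz right_minus_eq)
  have "M \<ge> 1" by (simp add: M_def)
  then have pos: "ln 2 / real M > 0" by simp
  have nat: "\<exists>w\<in>G. (\<Sum>x\<in>X. real (n x) * a x w) \<ge> ln 2 / M * (\<Sum>x\<in>X. real (n x))"
    if X: "finite X" "X \<subseteq> K \<times> E" for X n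
  proof -
    have "\<exists>w\<in>frontier D. (\<Sum>(k, e)\<in>X. real (n (k, e)) * (ln (norm (k - w)) - ln (norm (e - w))))
      \<ge> ln 2 / M * (\<Sum>x\<in>X. real (n x))"
    proof (rule boundary_point_with_large_log_ratio_average[where p = p])
      fix k e assume "(k, e) \<in> X"
      then have "k \<in> K" "e \<in> E" using X(2) by auto
      then show "k \<notin> frontier D \<and> e \<in> D \<and> degree (p k) \<le> M \<and> poly (p k) 0 = 2"
        using p(1)[of k] F(2) M[of "p k"] KG \<open>E \<subseteq> D\<close> unfolding G_def by blast
      show "norm (poly (p k) (inverse (w - k))) < 1" if "w \<in> frontier D" for w
        using p(2) \<open>k \<in> K\<close> that unfolding G_def by blast
    qed fact+
    then show ?thesis by (simp add: G_def a_def case_prod_beta)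
  qed
  have "\<exists>(m::nat) (w :: nat \<Rightarrow> complex). m \<ge> 1 \<and> (\<forall>j\<in>{1..m}. w j \<in> G) \<and>
      (\<forall>x\<in>K \<times> E. (\<Sum>j=1..m. a x (w j)) > 0)"
    using compact_Times[OF assms(1,2)] \<open>compact G\<close> cont pos nat by (rule sequence_with_positive_sums)
  then obtain m :: nat and w :: "nat \<Rightarrow> complex" where m: "m \<ge> 1" and w: "\<forall>j\<in>{1..m}. w j \<in> G"
    and gt: "\<forall>x\<in>K \<times> E. (\<Sum>j=1..m. a x (w j)) > 0"
    by blast
  have "norm (\<Prod>j=1..m. (e - w j)) < norm (\<Prod>j=1..m. (k - w j))" if ke: "k \<in> K" "e \<in> E" for k e
  proof -
    have "k - w j \<noteq> 0" "e - w j \<noteq> 0" if "j \<in> {1..m}" for j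
      using nz[OF ke] w that by blast+
    then have pos: "norm (k - w j) > 0" "norm (e - w j) > 0" if "j \<in> {1..m}" for j
      using that by simp_all
    have "0 < (\<Sum>j=1..m. a (k, e) (w j))" using gt ke by blast
    also have "\<dots> = ln (\<Prod>j=1..m. norm (k - w j)) - ln (\<Prod>j=1..m. norm (e - w j))"
      using pos by (subst (1 2) ln_prod) (auto simp: a_def sum_subtractf)
    finally have "ln (\<Prod>j=1..m. norm (e - w j)) < ln (\<Prod>j=1..m. norm (k - w j))" by simp
    moreover have "(\<Prod>j=1..m. norm (e - w j)) > 0" "(\<Prod>j=1..m. norm (k - w j)) > 0"
      using pos by (meson prod_pos)+
    ultimately show ?thesis by (simp add: prod_norm)
  qed
  moreover have "\<forall>j\<in>{1..m}. w j \<notin> K \<union> E" using w KG GE by blast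
  ultimately show ?thesis using m by blast
qed

theorem proposition3p1:
  fixes K P :: "complex set"
  assumes "compact K" and "compact P"
    and "K \<inter> polynomial_hull P = {}"
  shows "\<exists>(m::nat) (w :: nat \<Rightarrow> complex) (R1::real) (R2::real).
    m \<ge> 1 \<and> (\<forall>j\<in>{1..m}. w j \<in> UNIV - (K \<union> polynomial_hull P)) \<and>
    0 < R1 \<and> R1 < R2 \<and>
    (let f = (\<lambda>z. 1 / (\<Prod>j=1..m. (z - w j)));
         D = UNIV - w ` {1..m}
     in K \<subset>\<subset> {z\<in>D. norm (f z) < R1} \<and>
        P \<subset>\<subset> {z\<in>D. R1 < norm (f z) \<and> norm (f z) < R2})"
proof -
  let ?E = "polynomial_hull P"
  have PE: "P \<subseteq> ?E" using assms(2) by (rule polynomial_hull_superset)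
  have "\<exists>(m::nat) (w :: nat \<Rightarrow> complex). m \<ge> 1 \<and> (\<forall>j\<in>{1..m}. w j \<notin> K \<union> ?E) \<and>
    (\<forall>k\<in>K. \<forall>e\<in>?E. norm (\<Prod>j=1..m. (e - w j)) < norm (\<Prod>j=1..m. (k - w j)))"
  proof (cases "K = {} \<or> ?E = {}")
    case True
    have "bounded (K \<union> ?E)"
      using assms(1) compact_polynomial_hull compact_imp_bounded by auto
    then obtain v where "v \<notin> K \<union> ?E" by (metis UNIV_eq_I not_bounded_UNIV)
    then show ?thesis using True by (intro exI[of _ 1] exI[of _ "\<lambda>_. v"]) auto
  next
    case False
    then show ?thesis
      using separating_roots[OF assms(1) compact_polynomial_hull connected_compl_polynomial_hull assms(3)]
      by blast
  qed
  then obtain m :: nat and w :: "nat \<Rightarrow> complex" where m: "m \<ge> 1" and w: "\<forall>j\<in>{1..m}. w j \<notin> K \<union> ?E"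
    and lt: "\<forall>k\<in>K. \<forall>e\<in>?E. norm (\<Prod>j=1..m. (e - w j)) < norm (\<Prod>j=1..m. (k - w j))"
    by blast
  define q where "q z = norm (\<Prod>j=1..m. (z - w j))" for z
  have contq: "continuous_on A q" for A
    unfolding q_def by (intro continuous_intros)
  have qpos: "q z > 0" if "z \<in> K \<union> P" for z
    using w that PE by (auto simp: q_def)
  have fq: "norm (1 / (\<Prod>j=1..m. (z - w j))) = 1 / q z" for z
    by (simp add: q_def norm_divide)
  \<comment> \<open>The thresholds are \<open>R1 = 1 / t\<close> and \<open>R2 = 1 / s\<close>: \<open>t\<close> separates the values of \<open>q\<close> on \<open>P\<close> from
     those on \<open>K\<close>, and \<open>s\<close> lies below all values on \<open>P\<close>.\<close>
  have "\<exists>t>0. (\<forall>k\<in>K. t < q k) \<and> (\<forall>e\<in>P. q e < t)"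
  proof (cases "K = {}")
    case True
    obtain b where "\<forall>e\<in>P. q e \<le> b"
      using compact_imp_bounded[OF compact_continuous_image[OF contq assms(2)]]
      unfolding bounded_iff by auto (meson abs_le_D1)
    then show ?thesis using True by (intro exI[of _ "max 1 (b + 1)"]) force
  next
    case False
    then obtain k where k: "k \<in> K" "\<And>y. y \<in> K \<Longrightarrow> q k \<le> q y"
      using continuous_attains_inf[OF assms(1) _ contq] by blast
    show ?thesis
    proof (cases "P = {}")
      case True
      then show ?thesis using k qpos[of k] by (intro exI[of _ "q k / 2"]) force
    next
      case False
      then obtain e where e: "e \<in> P" "\<And>y. y \<in> P \<Longrightarrow> q y \<le> q e"
        using continuous_attains_sup[OF assms(2) _ contq] by blast
      then have "q e < q k" using lt k PE by (auto simp: q_def)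
      then obtain t where "q e < t" "t < q k" using dense by blast
      then show ?thesis using k e qpos[of e] by (intro exI[of _ t]) force
    qed
  qed
  then obtain t where t: "t > 0" "\<And>k. k \<in> K \<Longrightarrow> t < q k" "\<And>e. e \<in> P \<Longrightarrow> q e < t" by blast
  have "\<exists>s>0. s < t \<and> (\<forall>e\<in>P. s < q e)"
  proof (cases "P = {}")
    case True
    then show ?thesis using t(1) by (intro exI[of _ "t / 2"]) auto
  next
    case False
    then obtain e where e: "e \<in> P" "\<And>y. y \<in> P \<Longrightarrow> q e \<le> q y"
      using continuous_attains_inf[OF assms(2) _ contq] by blast
    then show ?thesis using t(3)[of e] qpos[of e] by (intro exI[of _ "q e / 2"]) force
  qed
  then obtain s where s: "s > 0" "s < t" "\<And>e. e \<in> P \<Longrightarrow> s < q e" by blast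
  have nw: "z \<notin> w ` {1..m}" if "z \<in> K \<union> P" for z
    using w that PE by blast
  have K: "K \<subset>\<subset> {z \<in> UNIV - w ` {1..m}. 1 / q z < 1 / t}"
    using nw t(1,2) assms(1) qpos
    by (auto simp: compactly_contained_def compact_imp_closed intro!: divide_strict_left_mono)
  have P: "P \<subset>\<subset> {z \<in> UNIV - w ` {1..m}. 1 / t < 1 / q z \<and> 1 / q z < 1 / s}"
    using nw t(1,3) s(1,3) assms(2) qpos
    by (auto simp: compactly_contained_def compact_imp_closed intro!: divide_strict_left_mono)
  have R: "0 < 1 / t" "1 / t < 1 / s" using s t(1) by (simp_all add: field_simps)
  have w': "\<forall>j\<in>{1..m}. w j \<in> UNIV - (K \<union> ?E)" using w by blast
  show ?thesis
    unfolding Let_def fq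
    by (rule exI[of _ m], rule exI[of _ w], rule exI[of _ "1 / t"], rule exI[of _ "1 / s"])
      (intro conjI m w' R K[folded fq] P[folded fq])
qed

end
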